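(* Let $f:\mathbb{R}^d\to\mathbb{R}^d$ be a homeomorphism, let $Q\subset\mathbb{R}^d$ be compact, and let $A_Q:=\bigcap_{k\in\mathbb{N}}f^k(Q)$. Let $(\rho_n)_{n=0}^\infty$ be a sequence of positive numbers with $\rho_n\searrow 0$ as $n\to\infty$, and let $(\Omega_n)_{n=0}^\infty$, $\Omega_n=\{D_i^n\subset\mathbb{R}^d: i\in I_n\}$, be a nested sequence of $\rho_n$-covers of $Q$. Suppose that the mappings $\varphi_n:I_n\to 2^{I_n}$ satisfy $$\big(f^{-1}(D_i^n)\cap Q\big)\subset\bigcup_{j\in\varphi_n(i)}D_j^n\quad\text{for all } i\in I_n,\ n\in\mathbb{N},$$ and $$\lim_{n\to\infty}\sup_{i\in I_n}\operatorname{dist}\Big(\bigcup_{j\in\varphi_n(i)}D_j^n,\ f^{-1}(D_i^n)\Big)=0.$$ Then the index sets $J_n$ computed by the subdivision algorithm (defined in the context) satisfy, for every $n\in\mathbb{N}$, $$A_Q\subset\bigcup_{j\in J_n}D^n_j\subset A^{\varphi_n}_{\Omega_n}.$$ In particular, the sets $\bigcup_{j\in J_n}D^n_j$ converge to $A_Q$ from above, i.e. they all contain $A_Q$ and $\lim_{n\to\infty}\operatorname{dist}\big(\bigcup_{j\in J_n}D^n_j,A_Q\big)=0$.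
   Context: $\mathbb{N}=\{0,1,2,\ldots\}$, and $\|\cdot\|$ is a fixed vector norm on $\mathbb{R}^d$. For $X,Y\subset\mathbb{R}^d$, $\operatorname{diam}(X)=\sup_{x\in X}\sup_{y\in X}\|x-y\|$ and $\operatorname{dist}(X,Y)=\sup_{x\in X}\inf_{y\in Y}\|x-y\|$ (a one-sided semidistance), with the conventions $\sup\emptyset=0$ and $\inf\emptyset=+\infty$. $2^I$ is the set of all subsets of $I$, including $\emptyset$. Cover: for $\rho>0$, a collection $\Omega=\{D_i\subset\mathbb{R}^d:i\in I\}$ is a $\rho$-cover of $Q$ if $I$ is finite, $Q=\bigcup_{i\in I}D_i$, $D_i\ne\emptyset$ and $\operatorname{diam}(D_i)\le\rho$ for all $i\in I$. A sequence of $\rho_n$-covers $\Omega_n=\{D_i^n:i\in I_n\}$ of $Q$ is nested if for every $n\in\mathbb{N}$ and $i\in I_{n+1}$ there is $j\in I_n$ with $D_i^{n+1}\subset D_j^n$. Discrete attractor: for $\varphi:I\to2^I$ put $\varphi^0(i)=\{i\}$ and $\varphi^{k+1}(i)=\bigcup_{j\in\varphi^k(i)}\varphi(j)$. For a cover $\Omega=\{D_i:i\in I\}$, let $I_\Omega^\varphi=\{i\in I:\varphi^k(i)\neq\emptyset\ \forall k\in\mathbb{N}\}$ and $A_\Omega^\varphi=\bigcup_{i\in I_\Omega^\varphi}D_i$. Subdivision algorithm: set $J_0^+:=I_0$. For $n=0,1,2,\ldots$: let $\psi_n:J_n^+\to2^{J_n^+}$, $\psi_n(i):=\varphi_n(i)\cap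 J_n^+$, be the restriction of $\varphi_n$ to $J_n^+$; set $J_n:=\{i\in J_n^+:\psi_n^k(i)\ne\emptyset\ \forall k\in\mathbb{N}\}$ (computed by recursively removing indices all of whose successors have been removed); then set $J_{n+1}^+:=\{i\in I_{n+1}:D_i^{n+1}\subset D_j^n\text{ for some }j\in J_n\}$. *)

theory Defs
  imports "HOL-Analysis.Analysis"
begin

text \<open>The norm is an arbitrary vector norm, passed as a parameter, since the norm of the type
  \<open>real ^ 'd\<close> is the Euclidean one. By equivalence of norms in finite dimension, the topological
  notions (compactness, homeomorphism) are those of the type.\<close>

definition vector_norm :: "('a::real_vector \<Rightarrow> real) \<Rightarrow> bool" where
  "vector_norm N \<longleftrightarrow>
     (\<forall>x. 0 \<le> N x) \<and> (\<forall>x. N x = 0 \<longleftrightarrow> x = 0) \<and>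
     (\<forall>c x. N (c *\<^sub>R x) = \<bar>c\<bar> * N x) \<and> (\<forall>x y. N (x + y) \<le> N x + N y)"

text \<open>In \<open>ennreal\<close>, the supremum of the empty set is \<open>0\<close> and the infimum of the empty set is
  \<open>\<infinity>\<close>. In particular, the semidistance from a nonempty set to the empty set is \<open>\<infinity>\<close>.\<close>

definition set_diam :: "('a::real_vector \<Rightarrow> real) \<Rightarrow> 'a set \<Rightarrow> ennreal" where
  "set_diam N X = (SUP x\<in>X. SUP y\<in>X. ennreal (N (x - y)))"

definition semidist :: "('a::real_vector \<Rightarrow> real) \<Rightarrow> 'a set \<Rightarrow> 'a set \<Rightarrow> ennreal" where
  "semidist N X Y = (SUP x\<in>X. INF y\<in>Y. ennreal (N (x - y)))"

definition is_cover ::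
    "('a::real_vector \<Rightarrow> real) \<Rightarrow> real \<Rightarrow> 'a set \<Rightarrow> 'i set \<Rightarrow> ('i \<Rightarrow> 'a set) \<Rightarrow> bool" where
  "is_cover N \<rho> Q I D \<longleftrightarrow>
     finite I \<and> Q = (\<Union>i\<in>I. D i) \<and> (\<forall>i\<in>I. D i \<noteq> {} \<and> set_diam N (D i) \<le> ennreal \<rho>)"

definition nested :: "(nat \<Rightarrow> 'i set) \<Rightarrow> (nat \<Rightarrow> 'i \<Rightarrow> 'a set) \<Rightarrow> bool" where
  "nested I D \<longleftrightarrow> (\<forall>n. \<forall>i\<in>I (Suc n). \<exists>j\<in>I n. D (Suc n) i \<subseteq> D n j)"

primrec iter :: "('i \<Rightarrow> 'i set) \<Rightarrow> nat \<Rightarrow> 'i \<Rightarrow> 'i set" where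
  "iter \<phi> 0 i = {i}"
| "iter \<phi> (Suc k) i = (\<Union>j\<in>iter \<phi> k i. \<phi> j)"

definition viable :: "('i \<Rightarrow> 'i set) \<Rightarrow> 'i set \<Rightarrow> 'i set" where
  "viable \<phi> I = {i \<in> I. \<forall>k. iter \<phi> k i \<noteq> {}}"

definition discrete_attractor :: "('i \<Rightarrow> 'i set) \<Rightarrow> 'i set \<Rightarrow> ('i \<Rightarrow> 'a set) \<Rightarrow> 'a set" where
  "discrete_attractor \<phi> I D = (\<Union>i\<in>viable \<phi> I. D i)"

definition restr :: "('i \<Rightarrow> 'i set) \<Rightarrow> 'i set \<Rightarrow> 'i \<Rightarrow> 'i set" where
  "restr \<phi> J i = \<phi> i \<inter> J"

text \<open>\<open>subdiv_plus I D \<phi> n\<close> is $J_n^+$ and \<open>subdiv I D \<phi> n\<close> is $J_n$. The \<open>viable\<close> term in the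
  second equation is $J_n$ written out.\<close>

primrec subdiv_plus ::
    "(nat \<Rightarrow> 'i set) \<Rightarrow> (nat \<Rightarrow> 'i \<Rightarrow> 'a set) \<Rightarrow> (nat \<Rightarrow> 'i \<Rightarrow> 'i set) \<Rightarrow> nat \<Rightarrow> 'i set" where
  "subdiv_plus I D \<phi> 0 = I 0"
| "subdiv_plus I D \<phi> (Suc n) =
     {i \<in> I (Suc n).
        \<exists>j\<in>viable (restr (\<phi> n) (subdiv_plus I D \<phi> n)) (subdiv_plus I D \<phi> n).
          D (Suc n) i \<subseteq> D n j}"

definition subdiv ::
    "(nat \<Rightarrow> 'i set) \<Rightarrow> (nat \<Rightarrow> 'i \<Rightarrow> 'a set) \<Rightarrow> (nat \<Rightarrow> 'i \<Rightarrow> 'i set) \<Rightarrow> nat \<Rightarrow> 'i set" where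
  "subdiv I D \<phi> n = viable (restr (\<phi> n) (subdiv_plus I D \<phi> n)) (subdiv_plus I D \<phi> n)"

definition attractor :: "('a \<Rightarrow> 'a) \<Rightarrow> 'a set \<Rightarrow> 'a set" where
  "attractor f Q = (\<Inter>k. (f ^^ k) ` Q)"

definition converges_from_above ::
    "('a::real_vector \<Rightarrow> real) \<Rightarrow> (nat \<Rightarrow> 'a set) \<Rightarrow> 'a set \<Rightarrow> bool" where
  "converges_from_above N S A \<longleftrightarrow>
     (\<forall>n. A \<subseteq> S n) \<and> (\<lambda>n. semidist N (S n) A) \<longlonglongrightarrow> 0"

end

theory Submission
  imports Defs
begin

text \<open>Every cell of level \<open>n\<close> meeting the attractor \<open>A\<close> has a successor meeting \<open>A\<close>, because
  \<open>f\<inverse>\<close> maps \<open>A\<close> into \<open>A \<subseteq> Q\<close>; by nestedness the algorithm therefore never discards such a cell.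
  For convergence, a viable cell admits discrete backward trajectories of every length \<open>k\<close>.
  Along a convergent sequence of points in viable cells of finer and finer covers, the first steps
  of these trajectories converge to the image of the limit under \<open>f\<inverse>\<close>, so iterating this \<open>k\<close>
  times shows that the limit lies in \<open>f\<^sup>k(Q)\<close>. Compactness of \<open>Q\<close> does the rest.\<close>

section \<open>Topology of an arbitrary vector norm\<close>

lemma continuous_on_vector_norm:
  fixes N :: "'a::euclidean_space \<Rightarrow> real"
  assumes "vector_norm N"
  shows "continuous_on S N"
proof -
  \<comment> \<open>Homogeneity and the triangle inequality give convexity, and a real-valued convex
    function on an open set in finite dimension is continuous.\<close>
  have "convex_on UNIV N"
  proof (rule convex_onI)
    fix t :: real and x y :: 'a
    assume "0 < t" "t < 1"
    have "N ((1 - t) *\<^sub>R x + t *\<^sub>R y) \<le> N ((1 - t) *\<^sub>R x) + N (t *\<^sub>R y)"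
      using assms unfolding vector_norm_def by blast
    also have "\<dots> = \<bar>1 - t\<bar> * N x + \<bar>t\<bar> * N y"
      using assms unfolding vector_norm_def by presburger
    finally show "N ((1 - t) *\<^sub>R x + t *\<^sub>R y) \<le> (1 - t) * N x + t * N y"
      using \<open>0 < t\<close> \<open>t < 1\<close> by simp
  qed simp
  then have "continuous_on UNIV N" by (rule convex_on_continuous[OF open_UNIV])
  then show ?thesis by (rule continuous_on_subset) simp
qed

text \<open>By compactness \<open>N\<close> attains its minimum on the Euclidean unit sphere;
  definiteness makes it positive, and homogeneity carries the bound to all vectors.\<close>

lemma vector_norm_lower_bound:
  fixes N :: "'a::euclidean_space \<Rightarrow> real"
  assumes "vector_norm N"
  shows "\<exists>m>0. \<forall>x. m * norm x \<le> N x"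
proof -
  have sphere: "compact (sphere (0::'a) 1)" "sphere (0::'a) 1 \<noteq> {}" by auto
  obtain u where u: "u \<in> sphere 0 1" "\<And>x. x \<in> sphere 0 1 \<Longrightarrow> N u \<le> N x"
    using continuous_attains_inf[OF sphere continuous_on_vector_norm[OF assms]] by blast
  show ?thesis
  proof (intro exI[of _ "N u"] conjI allI)
    have "u \<noteq> 0" using u(1) by auto
    then show "0 < N u" using assms unfolding vector_norm_def by (metis less_eq_real_def)
  next
    fix x :: 'a
    show "N u * norm x \<le> N x"
    proof (cases "x = 0")
      case True
      then show ?thesis using assms unfolding vector_norm_def by simp
    next
      case False
      then have "N u \<le> N (inverse (norm x) *\<^sub>R x)" by (intro u(2)) simp
      also have "\<dots> = inverse (norm x) * N x"
        using assms unfolding vector_norm_def by simp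
      finally show ?thesis using False by (simp add: field_simps)
    qed
  qed
qed

lemma vector_norm_tendsto_0_iff:
  fixes N :: "'a::euclidean_space \<Rightarrow> real"
  assumes "vector_norm N"
  shows "((\<lambda>n. N (x n)) \<longlongrightarrow> 0) F \<longleftrightarrow> (x \<longlongrightarrow> 0) F"
proof
  assume lim: "((\<lambda>n. N (x n)) \<longlongrightarrow> 0) F"
  obtain m where m: "0 < m" "\<And>x. m * norm x \<le> N x"
    using vector_norm_lower_bound[OF assms] by blast
  have "((\<lambda>n. N (x n) / m) \<longlongrightarrow> 0) F" using lim m(1) by (auto intro: tendsto_divide_zero)
  moreover have "norm (x n) \<le> N (x n) / m" for n
    using m by (simp add: field_simps)
  ultimately show "(x \<longlongrightarrow> 0) F"
    by (intro Lim_null_comparison[of x "\<lambda>n. N (x n) / m"] always_eventually allI)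
next
  assume "(x \<longlongrightarrow> 0) F"
  then have "((\<lambda>n. N (x n)) \<longlongrightarrow> N 0) F"
    using continuous_on_vector_norm[OF assms, of UNIV]
    by (auto intro: continuous_on_tendsto_compose)
  moreover have "N 0 = 0" using assms unfolding vector_norm_def by blast
  ultimately show "((\<lambda>n. N (x n)) \<longlongrightarrow> 0) F" by simp
qed

text \<open>Bridge from the \<open>ennreal\<close> bounds supplied by diameters and semidistances to
  convergence in the topology of the type.\<close>

lemma ennreal_vector_norm_tendsto_0:
  fixes N :: "'a::euclidean_space \<Rightarrow> real"
  assumes "vector_norm N" and "e \<longlonglongrightarrow> 0" and "\<And>n. ennreal (N (x n)) \<le> e n"
  shows "x \<longlonglongrightarrow> 0"
proof -
  have "(\<lambda>n. ennreal (N (x n))) \<longlonglongrightarrow> 0"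
    using assms(2,3) by (intro tendsto_sandwich[OF _ _ tendsto_const assms(2)]) auto
  moreover have "0 \<le> N z" for z using assms(1) unfolding vector_norm_def by blast
  ultimately have "(\<lambda>n. N (x n)) \<longlonglongrightarrow> 0"
    using tendsto_ennreal_iff[of "\<lambda>n. N (x n)" sequentially 0] by simp
  then show ?thesis unfolding vector_norm_tendsto_0_iff[OF assms(1)] .
qed

section \<open>Diameter and one-sided semidistance\<close>

lemma le_set_diam:
  assumes "x \<in> X" "y \<in> X"
  shows "ennreal (N (x - y)) \<le> set_diam N X"
  unfolding set_diam_def using assms by (meson SUP_upper2 order_refl)

lemma semidist_mono_left:
  assumes "X \<subseteq> X'"
  shows "semidist N X Y \<le> semidist N X' Y"
  unfolding semidist_def using assms by (intro SUP_subset_mono) auto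

text \<open>The infimum over \<open>Y\<close> need not be attained, hence the slack
  \<open>\<delta>\<close>. It yields a strict inequality only for finite \<open>e\<close>; for
  \<open>e = top\<close> any point of \<open>Y\<close> serves.\<close>

lemma semidist_approx:
  assumes "x \<in> X" "Y \<noteq> {}" "semidist N X Y \<le> e" "0 < \<delta>"
  obtains y where "y \<in> Y" "ennreal (N (x - y)) \<le> e + \<delta>"
proof (cases "e = top")
  case True
  then show thesis using that assms(2) by fastforce
next
  case False
  have "(INF y\<in>Y. ennreal (N (x - y))) \<le> e"
    using assms(1,3) unfolding semidist_def by (meson SUP_le_iff)
  also have "e < e + \<delta>" 
    using False assms(4) ennreal_add_left_cancel_less[of e 0 \<delta>] by simp
  finally show thesis using that unfolding INF_less_iff by (meson less_imp_le)
qed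

section \<open>Discrete trajectories and viable indices\<close>

lemma iter_Suc_left: "iter \<phi> (Suc k) i = (\<Union>j\<in>\<phi> i. iter \<phi> k j)"
  by (induction k) auto

lemma iter_mono:
  assumes "\<And>i. \<psi> i \<subseteq> \<phi> i"
  shows "iter \<psi> k i \<subseteq> iter \<phi> k i"
proof (induction k)
  case (Suc k)
  then show ?case using assms by fastforce
qed simp

lemma viable_mono:
  assumes "\<And>i. \<psi> i \<subseteq> \<phi> i" "J \<subseteq> I"
  shows "viable \<psi> J \<subseteq> viable \<phi> I"
  using iter_mono[of \<psi> \<phi>, OF assms(1)] assms(2) unfolding viable_def by blast

text \<open>Choosing successors inside \<open>K\<close> again and again builds trajectories of every
  length.\<close>

lemma viableI_invariant:
  assumes "K \<subseteq> I" and "\<And>i. i \<in> K \<Longrightarrow> \<phi> i \<inter> K \<noteq> {}"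
  shows "K \<subseteq> viable \<phi> I"
proof -
  have "iter \<phi> k i \<noteq> {}" if "i \<in> K" for i k
    using that
  proof (induction k arbitrary: i)
    case (Suc k)
    then obtain j where "j \<in> \<phi> i" "j \<in> K" using assms(2) by blast
    \<comment> \<open>The definition of \<open>iter\<close> appends the last step;
      \<open>iter_Suc_left\<close> splits off the first one, so that the induction hypothesis
      applies to the successor \<open>j\<close>.\<close>
    then show ?case using Suc.IH unfolding iter_Suc_left by blast
  qed simp
  then show ?thesis using assms(1) unfolding viable_def by blast
qed

lemma subdiv_plus_subset: "subdiv_plus I D \<phi> n \<subseteq> I n"
  by (cases n) auto

lemma subdiv_subset_viable: "subdiv I D \<phi> n \<subseteq> viable (\<phi> n) (I n)"
  unfolding subdiv_def by (intro viable_mono subdiv_plus_subset) (simp add: restr_def)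

section \<open>The attractor and the cells that meet it\<close>

lemma attractor_subset: "attractor f Q \<subseteq> Q"
  unfolding attractor_def by (rule INF_lower2[of 0]) auto

text \<open>For each \<open>k\<close>, \<open>f y\<close> lies in the image of \<open>Q\<close>
  under \<open>f ^^ Suc k\<close>; injectivity cancels one \<open>f\<close>.\<close>

lemma attractor_preimage:
  assumes "inj f" "f y \<in> attractor f Q"
  shows "y \<in> attractor f Q"
proof -
  have "y \<in> (f ^^ k) ` Q" for k
  proof -
    have "f y \<in> (f ^^ Suc k) ` Q" using assms(2) unfolding attractor_def by blast
    then show ?thesis using assms(1) by (auto dest: injD)
  qed
  then show ?thesis unfolding attractor_def by blast
qed

lemma cells_meeting_attractor:
  assumes bij: "bij f"
    and nested: "nested I D"
    and maps: "\<And>n. \<phi> n \<in> I n \<rightarrow> Pow (I n)"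
    and succ: "\<And>n i. i \<in> I n \<Longrightarrow> f -` D n i \<inter> Q \<subseteq> (\<Union>j\<in>\<phi> n i. D n j)"
  shows "{i \<in> I n. D n i \<inter> attractor f Q \<noteq> {}} \<subseteq> subdiv I D \<phi> n"
proof -
  define K where "K n = {i \<in> I n. D n i \<inter> attractor f Q \<noteq> {}}" for n
  \<comment> \<open>Every index in \<open>K n\<close> has a successor in \<open>K n\<close>, so
    restricting \<open>\<phi> n\<close> to a set that contains \<open>K n\<close> cannot make it die
    out.\<close>
  have step: "K n \<subseteq> subdiv I D \<phi> n" if "K n \<subseteq> subdiv_plus I D \<phi> n" for n
    unfolding subdiv_def
  proof (rule viableI_invariant[OF that])
    fix i assume "i \<in> K n"
    then obtain x where x: "i \<in> I n" "x \<in> D n i" "x \<in> attractor f Q"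
      unfolding K_def by blast
    obtain y where y: "x = f y" using bij_is_surj[OF bij] by (rule surjE)
    have yA: "y \<in> attractor f Q"
      using attractor_preimage[OF bij_is_inj[OF bij]] x(3) unfolding y .
    then have "y \<in> f -` D n i \<inter> Q" using subsetD[OF attractor_subset] x(2) y by auto
    then obtain j where j: "j \<in> \<phi> n i" "y \<in> D n j" using succ[OF x(1)] by blast
    then have "j \<in> I n" using maps[of n] x(1) by blast
    then have "j \<in> K n" using yA j(2) unfolding K_def by blast
    then show "restr (\<phi> n) (subdiv_plus I D \<phi> n) i \<inter> K n \<noteq> {}"
      using that j(1) unfolding restr_def by blast
  qed
  \<comment> \<open>The parent of a cell indexed by \<open>K (Suc n)\<close> contains its points of
    the attractor, so the parent lies in \<open>K n\<close> and survives by \<open>step\<close>;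
    hence the child is kept.\<close>
  have "K n \<subseteq> subdiv_plus I D \<phi> n" for n
  proof (induction n)
    case 0
    then show ?case unfolding K_def by auto
  next
    case (Suc n)
    show ?case
    proof
      fix i assume i: "i \<in> K (Suc n)"
      then obtain j where j: "j \<in> I n" "D (Suc n) i \<subseteq> D n j"
        using nested unfolding nested_def K_def by blast
      then have "j \<in> K n" using i unfolding K_def by blast
      then show "i \<in> subdiv_plus I D \<phi> (Suc n)"
        using i j(2) step[OF Suc.IH] unfolding K_def subdiv_def by auto
    qed
  qed
  then show ?thesis using step unfolding K_def by blast
qed

lemma attractor_subset_subdiv:
  assumes "bij f"
    and cover: "\<And>n. Q = (\<Union>i\<in>I n. D n i)"
    and "nested I D"
    and "\<And>n. \<phi> n \<in> I n \<rightarrow> Pow (I n)"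
    and "\<And>n i. i \<in> I n \<Longrightarrow> f -` D n i \<inter> Q \<subseteq> (\<Union>j\<in>\<phi> n i. D n j)"
  shows "attractor f Q \<subseteq> (\<Union>j\<in>subdiv I D \<phi> n. D n j)"
proof
  fix x assume x: "x \<in> attractor f Q"
  then have "x \<in> (\<Union>i\<in>I n. D n i)" using subsetD[OF attractor_subset] cover[of n] by metis
  then obtain i where i: "i \<in> I n" "x \<in> D n i" by blast
  have "i \<in> subdiv I D \<phi> n"
    using i x by (intro subsetD[OF cells_meeting_attractor[of f I D \<phi> Q, OF assms(1,3-5)]]) auto
  then show "x \<in> (\<Union>j\<in>subdiv I D \<phi> n. D n j)" using i(2) by blast
qed

section \<open>Convergence of the discrete attractors\<close>

lemma limit_in_funpow_image:
  fixes N :: "'a::euclidean_space \<Rightarrow> real"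
  assumes N: "vector_norm N"
    and Q: "closed Q"
    and g: "continuous_on UNIV g" "\<And>x. g (f x) = x" "\<And>x. f (g x) = x"
    and \<rho>: "\<rho> \<longlonglongrightarrow> 0"
    and cover: "\<And>n. is_cover N (\<rho> n) Q (I n) (D n)"
    and maps: "\<And>n. \<phi> n \<in> I n \<rightarrow> Pow (I n)"
    and e: "e \<longlonglongrightarrow> 0"
      "\<And>n i. i \<in> I n \<Longrightarrow> semidist N (\<Union>j\<in>\<phi> n i. D n j) (f -` D n i) \<le> e n"
    and s: "strict_mono s"
    and x: "x \<longlonglongrightarrow> l" "\<And>n. i n \<in> I (s n)" "\<And>n. x n \<in> D (s n) (i n)"
      "\<And>n. iter (\<phi> (s n)) k (i n) \<noteq> {}"
  shows "l \<in> (f ^^ k) ` Q"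
  \<comment> \<open>The induction step replaces \<open>l\<close> by \<open>g l\<close> and the
    points \<open>x\<close> by points in successor cells. These converge along the same indices
    \<open>s\<close>, so no further subsequence is taken.\<close>
  using x
proof (induction k arbitrary: x i l)
  case 0
  have "x n \<in> Q" for n using cover[of "s n"] 0(2,3)[of n] unfolding is_cover_def by blast
  then show ?case using closed_sequentially[OF Q] 0(1) by auto
next
  case (Suc k)
  define \<delta> :: "nat \<Rightarrow> ennreal" where "\<delta> n = ennreal (inverse (real (Suc n)))" for n
  \<comment> \<open>\<open>i'\<close> is the second index of a trajectory of length
    \<open>Suc k\<close>, \<open>x'\<close> any point of its cell, and \<open>y\<close> a point
    close to \<open>x'\<close> in the preimage of the old cell.\<close>
  have "\<exists>i' x' y. i' \<in> I (s n) \<and> iter (\<phi> (s n)) k i' \<noteq> {} \<and> x' \<in> D (s n) i' \<and>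
      f y \<in> D (s n) (i n) \<and> ennreal (N (x' - y)) \<le> e (s n) + \<delta> n" for n
  proof -
    obtain i' where i': "i' \<in> \<phi> (s n) (i n)" "iter (\<phi> (s n)) k i' \<noteq> {}"
      using Suc.prems(4)[of n] unfolding iter_Suc_left by blast
    then have I: "i' \<in> I (s n)" using maps[of "s n"] Suc.prems(2)[of n] by blast
    then obtain x' where x': "x' \<in> D (s n) i'" using cover[of "s n"] unfolding is_cover_def by blast
    \<comment> \<open>An empty preimage would offer no approximating point; surjectivity of
      \<open>f\<close> excludes it.\<close>
    have "g (x n) \<in> f -` D (s n) (i n)" using Suc.prems(3)[of n] by (simp add: g(3))
    then have "f -` D (s n) (i n) \<noteq> {}" by blast
    then obtain y where "y \<in> f -` D (s n) (i n)" "ennreal (N (x' - y)) \<le> e (s n) + \<delta> n"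
      using semidist_approx[of x' "\<Union>j\<in>\<phi> (s n) (i n). D (s n) j" "f -` D (s n) (i n)" N "e (s n)" "\<delta> n"]
        e(2)[OF Suc.prems(2)[of n]] x' i'(1) unfolding \<delta>_def by auto
    then show ?thesis using I i'(2) x' by auto
  qed
  then obtain i' x' y where *: "\<And>n. i' n \<in> I (s n)" "\<And>n. iter (\<phi> (s n)) k (i' n) \<noteq> {}"
    "\<And>n. x' n \<in> D (s n) (i' n)" "\<And>n. f (y n) \<in> D (s n) (i n)"
    "\<And>n. ennreal (N (x' n - y n)) \<le> e (s n) + \<delta> n"
    by metis
  \<comment> \<open>\<open>f (y n)\<close> and \<open>x n\<close> share a cell, so the vanishing
    diameters force a common limit.\<close>
  have "(\<lambda>n. f (y n) - x n) \<longlonglongrightarrow> 0"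
  proof (rule ennreal_vector_norm_tendsto_0[OF N])
    show "(\<lambda>n. ennreal (\<rho> (s n))) \<longlonglongrightarrow> 0"
      using tendsto_ennrealI[OF LIMSEQ_subseq_LIMSEQ[OF \<rho> s]] by (simp add: o_def)
    show "ennreal (N (f (y n) - x n)) \<le> ennreal (\<rho> (s n))" for n
      using le_set_diam[OF *(4) Suc.prems(3)] cover Suc.prems(2)
      unfolding is_cover_def by (meson order_trans)
  qed
  then have "(\<lambda>n. f (y n)) \<longlonglongrightarrow> l"
    using tendsto_add[OF _ Suc.prems(1)] by fastforce
  then have "(\<lambda>n. g (f (y n))) \<longlonglongrightarrow> g l"
    using g(1) by (auto intro: continuous_on_tendsto_compose)
  then have y: "y \<longlonglongrightarrow> g l" by (simp add: g(2))
  have "(\<lambda>n. x' n - y n) \<longlonglongrightarrow> 0"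
  proof (rule ennreal_vector_norm_tendsto_0[OF N])
    have "\<delta> \<longlonglongrightarrow> 0"
      using tendsto_ennrealI[OF LIMSEQ_inverse_real_of_nat] unfolding \<delta>_def by simp
    then show "(\<lambda>n. e (s n) + \<delta> n) \<longlonglongrightarrow> 0"
      using tendsto_add[OF LIMSEQ_subseq_LIMSEQ[OF e(1) s]] by (fastforce simp: o_def)
  qed (rule *(5))
  then have "x' \<longlonglongrightarrow> g l" using tendsto_add[OF _ y] by fastforce
  then have "g l \<in> (f ^^ k) ` Q" using Suc.IH *(1-3) by blast
  then have "f (g l) \<in> (f ^^ Suc k) ` Q" by auto
  then show ?case by (simp only: g(3))
qed

text \<open>Otherwise points of viable cells at infinitely many levels stay more than a fixed
  \<open>b\<close> away from the attractor; the limit of a subsequence lies in every forward image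
  of \<open>Q\<close>, hence in the attractor.\<close>

lemma semidist_discrete_attractor_tendsto_0:
  fixes N :: "'a::euclidean_space \<Rightarrow> real"
  assumes N: "vector_norm N"
    and Q: "compact Q"
    and g: "continuous_on UNIV g" "\<And>x. g (f x) = x" "\<And>x. f (g x) = x"
    and \<rho>: "\<rho> \<longlonglongrightarrow> 0"
    and cover: "\<And>n. is_cover N (\<rho> n) Q (I n) (D n)"
    and maps: "\<And>n. \<phi> n \<in> I n \<rightarrow> Pow (I n)"
    and e: "(\<lambda>n. SUP i\<in>I n. semidist N (\<Union>j\<in>\<phi> n i. D n j) (f -` D n i)) \<longlonglongrightarrow> 0"
  shows "(\<lambda>n. semidist N (discrete_attractor (\<phi> n) (I n) (D n)) (attractor f Q)) \<longlonglongrightarrow> 0"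
proof (rule order_tendstoI)
  fix a :: ennreal
  assume "0 < a"
  let ?S = "\<lambda>n. semidist N (discrete_attractor (\<phi> n) (I n) (D n)) (attractor f Q)"
  show "eventually (\<lambda>n. ?S n < a) sequentially"
  proof (rule ccontr)
    assume not: "\<not> ?thesis"
    obtain r :: "nat \<Rightarrow> nat" where r: "strict_mono r" "\<And>n. \<not> ?S (r n) < a"
      using not_eventually_sequentiallyD[OF not] by blast
    \<comment> \<open>The strict inequality \<open>b < ?S (r n)\<close> is what extracts witnesses
      from the supremum.\<close>
    obtain b where b: "0 < b" "b < a" using dense[OF \<open>0 < a\<close>] by blast
    have "\<exists>i x. i \<in> viable (\<phi> (r n)) (I (r n)) \<and> x \<in> D (r n) i \<and>
        b < (INF y\<in>attractor f Q. ennreal (N (x - y)))" for n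
    proof -
      have "b < ?S (r n)" using r(2) b(2) by (meson less_le_trans not_less)
      then show ?thesis unfolding semidist_def less_SUP_iff discrete_attractor_def by blast
    qed
    then obtain i x where ix: "\<And>n. i n \<in> viable (\<phi> (r n)) (I (r n))" "\<And>n. x n \<in> D (r n) (i n)"
      "\<And>n. b < (INF y\<in>attractor f Q. ennreal (N (x n - y)))"
      by metis
    have "x n \<in> Q" for n using ix(1,2)[of n] cover[of "r n"] unfolding is_cover_def viable_def by blast
    then obtain l t where lt: "strict_mono t" "(x \<circ> t) \<longlonglongrightarrow> l"
      using Q unfolding compact_def by metis
    \<comment> \<open>One limit serves all \<open>k\<close>, because viable indices have
      trajectories of every length.\<close>
    have "l \<in> (f ^^ k) ` Q" for k
    proof (rule limit_in_funpow_image[OF N compact_imp_closed[OF Q] g \<rho> cover maps e _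
          strict_mono_o[OF r(1) lt(1)] lt(2)])
      show "semidist N (\<Union>j\<in>\<phi> n i. D n j) (f -` D n i)
          \<le> (SUP i\<in>I n. semidist N (\<Union>j\<in>\<phi> n i. D n j) (f -` D n i))" if "i \<in> I n" for n i
        using that by (rule SUP_upper)
      show "(i \<circ> t) n \<in> I ((r \<circ> t) n)" "(x \<circ> t) n \<in> D ((r \<circ> t) n) ((i \<circ> t) n)"
        "iter (\<phi> ((r \<circ> t) n)) k ((i \<circ> t) n) \<noteq> {}" for n
        using ix(1,2)[of "t n"] unfolding viable_def by auto
    qed
    \<comment> \<open>This covers an empty attractor too, where the infimum in \<open>ix\<close> is
      \<open>top\<close>: the limit just found contradicts emptiness.\<close>
    then have l: "l \<in> attractor f Q" unfolding attractor_def by blast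
    have "b \<le> ennreal (N (x (t n) - l))" for n
      using ix(3)[of "t n"] INF_lower[OF l, of "\<lambda>y. ennreal (N (x (t n) - y))"] by simp
    moreover have "(\<lambda>n. N (x (t n) - l)) \<longlonglongrightarrow> 0"
      using lt(2) unfolding vector_norm_tendsto_0_iff[OF N] by (simp add: LIM_zero o_def)
    then have "(\<lambda>n. ennreal (N (x (t n) - l))) \<longlonglongrightarrow> 0" using tendsto_ennrealI by fastforce
    ultimately have "b \<le> 0" using LIMSEQ_le_const by blast
    then show False using b(1) by simp
  qed
qed simp

theorem proposition8:
  fixes N :: "real ^ 'd \<Rightarrow> real"
    and f :: "real ^ 'd \<Rightarrow> real ^ 'd"
    and Q :: "(real ^ 'd) set"
    and \<rho> :: "nat \<Rightarrow> real"
    and I :: "nat \<Rightarrow> 'i set"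
    and D :: "nat \<Rightarrow> 'i \<Rightarrow> (real ^ 'd) set"
    and \<phi> :: "nat \<Rightarrow> 'i \<Rightarrow> 'i set"
  assumes "vector_norm N"
    and "homeomorphic_map euclidean euclidean f"
    and "compact Q"
    and "\<And>n. 0 < \<rho> n" and "decseq \<rho>" and "\<rho> \<longlonglongrightarrow> 0"
    and "\<And>n. is_cover N (\<rho> n) Q (I n) (D n)"
    and "nested I D"
    and "\<And>n. \<phi> n \<in> I n \<rightarrow> Pow (I n)"
    and "\<And>n i. i \<in> I n \<Longrightarrow> f -` D n i \<inter> Q \<subseteq> (\<Union>j\<in>\<phi> n i. D n j)"
    and "(\<lambda>n. SUP i\<in>I n. semidist N (\<Union>j\<in>\<phi> n i. D n j) (f -` D n i)) \<longlonglongrightarrow> 0"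
  shows "(\<forall>n. attractor f Q \<subseteq> (\<Union>j\<in>subdiv I D \<phi> n. D n j) \<and>
              (\<Union>j\<in>subdiv I D \<phi> n. D n j) \<subseteq> discrete_attractor (\<phi> n) (I n) (D n)) \<and>
         converges_from_above N (\<lambda>n. \<Union>j\<in>subdiv I D \<phi> n. D n j) (attractor f Q)"
proof -
  obtain g where "homeomorphic_maps euclidean euclidean f g"
    using assms(2) unfolding homeomorphic_map_maps by blast
  then have g: "continuous_on UNIV g" "\<And>x. g (f x) = x" "\<And>x. f (g x) = x"
    unfolding homeomorphic_maps_def by auto
  then have bij: "bij f" by (metis bijI')
  have cover: "\<And>n. Q = (\<Union>i\<in>I n. D n i)" using assms(7) unfolding is_cover_def by blast
  have lower: "attractor f Q \<subseteq> (\<Union>j\<in>subdiv I D \<phi> n. D n j)" for n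
    using attractor_subset_subdiv[OF bij cover assms(8-10)] .
  have upper: "(\<Union>j\<in>subdiv I D \<phi> n. D n j) \<subseteq> discrete_attractor (\<phi> n) (I n) (D n)" for n
    unfolding discrete_attractor_def by (intro UN_mono subdiv_subset_viable) simp
  \<comment> \<open>Squeeze between \<open>0\<close> and the semidistance of the larger discrete
    attractor.\<close>
  have "(\<lambda>n. semidist N (\<Union>j\<in>subdiv I D \<phi> n. D n j) (attractor f Q)) \<longlonglongrightarrow> 0"
    using semidist_mono_left[OF upper]
    by (intro tendsto_sandwich[OF _ _ tendsto_const
          semidist_discrete_attractor_tendsto_0[OF assms(1,3) g assms(6,7,9,11)]]) auto
  then show ?thesis using lower upper unfolding converges_from_above_def by blast
qed

end
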